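(* For every positive integer $n$ there exist infinitely many integers $h$ such that the quintic equation in the five variables $x_1,x_2,x_4,x_5,x_6$ $$\begin{aligned} &72(9x_1^3-9hx_1^2x_2-18(h+2)x_1x_2^2-8(h+3)x_2^3)(3x_1^2+6x_1x_2+4x_2^2)\\ &=13\{81x_4^3-81hx_4^2x_5+81(h^2+4h+8)x_4^2x_6-162(h+2)x_4x_5^2\\ &\quad+(162h^2+540h+648)x_4x_5x_6+(180h^2+864h+1296)x_4x_6^2\\ &\quad-72(h+3)x_5^3+72h(h+3)x_5^2x_6+144(h+3)(h+2)x_5x_6^2+64(h+3)^2x_6^3\}\\ &\quad\times\{(x_4+x_5+x_6)^2+(h+3)(49x_4^2-36x_5^2+x_6^2)\} \end{aligned}$$ has at least $n$ distinct rational (hence, on scaling, integer) solutions with $(x_1,x_2)\neq(0,0)$ and $(x_4,x_5,x_6)\neq(0,0,0)$.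
   Context: Solutions differing by a nonzero rational scalar factor are regarded as equivalent and counted once. *)

theory Defs
  imports Complex_Main
begin

type_synonym quintuple = "rat \<times> rat \<times> rat \<times> rat \<times> rat"

definition binary_cubic :: "rat \<Rightarrow> rat \<Rightarrow> rat \<Rightarrow> rat" where
  "binary_cubic h x1 x2 =
     9 * x1^3 - 9 * h * x1^2 * x2 - 18 * (h + 2) * x1 * x2^2 - 8 * (h + 3) * x2^3"

definition binary_quadratic :: "rat \<Rightarrow> rat \<Rightarrow> rat" where
  "binary_quadratic x1 x2 = 3 * x1^2 + 6 * x1 * x2 + 4 * x2^2"

definition quintic_lhs :: "rat \<Rightarrow> rat \<Rightarrow> rat \<Rightarrow> rat" where
  "quintic_lhs h x1 x2 = 72 * binary_cubic h x1 x2 * binary_quadratic x1 x2"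

definition ternary_cubic :: "rat \<Rightarrow> rat \<Rightarrow> rat \<Rightarrow> rat \<Rightarrow> rat" where
  "ternary_cubic h x4 x5 x6 =
     81 * x4^3 - 81 * h * x4^2 * x5 + 81 * (h^2 + 4 * h + 8) * x4^2 * x6
     - 162 * (h + 2) * x4 * x5^2
     + (162 * h^2 + 540 * h + 648) * x4 * x5 * x6
     + (180 * h^2 + 864 * h + 1296) * x4 * x6^2
     - 72 * (h + 3) * x5^3 + 72 * h * (h + 3) * x5^2 * x6
     + 144 * (h + 3) * (h + 2) * x5 * x6^2 + 64 * (h + 3)^2 * x6^3"

definition ternary_quadratic :: "rat \<Rightarrow> rat \<Rightarrow> rat \<Rightarrow> rat \<Rightarrow> rat" where
  "ternary_quadratic h x4 x5 x6 =
     (x4 + x5 + x6)^2 + (h + 3) * (49 * x4^2 - 36 * x5^2 + x6^2)"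

definition quintic_rhs :: "rat \<Rightarrow> rat \<Rightarrow> rat \<Rightarrow> rat \<Rightarrow> rat" where
  "quintic_rhs h x4 x5 x6 = 13 * ternary_cubic h x4 x5 x6 * ternary_quadratic h x4 x5 x6"

definition quintic_solutions :: "int \<Rightarrow> quintuple set" where
  "quintic_solutions h =
     {(x1, x2, x4, x5, x6).
        quintic_lhs (of_int h) x1 x2 = quintic_rhs (of_int h) x4 x5 x6 \<and>
        (x1, x2) \<noteq> (0, 0) \<and> (x4, x5, x6) \<noteq> (0, 0, 0)}"

definition scale_quintuple :: "rat \<Rightarrow> quintuple \<Rightarrow> quintuple" where
  "scale_quintuple c = (\<lambda>(x1, x2, x4, x5, x6). (c * x1, c * x2, c * x4, c * x5, c * x6))"

definition integer_quintuple :: "quintuple \<Rightarrow> bool" where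
  "integer_quintuple = (\<lambda>(x1, x2, x4, x5, x6). {x1, x2, x4, x5, x6} \<subseteq> \<int>)"

definition scalar_equiv :: "int \<Rightarrow> (quintuple \<times> quintuple) set" where
  "scalar_equiv h =
     {(x, y). x \<in> quintic_solutions h \<and> y \<in> quintic_solutions h \<and> (\<exists>c. c \<noteq> 0 \<and> y = scale_quintuple c x)}"

lemma equiv_scalar_equiv: "equiv (quintic_solutions h) (scalar_equiv h)"
proof (rule equivI)
  show "scalar_equiv h \<subseteq> quintic_solutions h \<times> quintic_solutions h"
    by (auto simp: scalar_equiv_def simp del: split_paired_All)
  show "refl_on (quintic_solutions h) (scalar_equiv h)"
  proof (rule refl_onI)
    fix x assume "x \<in> quintic_solutions h"
    moreover have "(1 :: rat) \<noteq> 0 \<and> x = scale_quintuple 1 x"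
      by (simp add: scale_quintuple_def split_def)
    ultimately show "(x, x) \<in> scalar_equiv h"
      unfolding scalar_equiv_def mem_Collect_eq prod.case by iprover
  qed
  show "sym (scalar_equiv h)"
  proof (rule symI)
    fix x y assume "(x, y) \<in> scalar_equiv h"
    then obtain c where c: "x \<in> quintic_solutions h" "y \<in> quintic_solutions h"
      "c \<noteq> 0" "y = scale_quintuple c x"
      unfolding scalar_equiv_def mem_Collect_eq prod.case by iprover
    then have "inverse c \<noteq> 0 \<and> x = scale_quintuple (inverse c) y"
      by (simp add: scale_quintuple_def split_def flip: mult.assoc)
    with c show "(y, x) \<in> scalar_equiv h"
      unfolding scalar_equiv_def mem_Collect_eq prod.case by iprover
  qed
  show "trans (scalar_equiv h)"
  proof (rule transI)
    fix x y z assume xy: "(x, y) \<in> scalar_equiv h" and yz: "(y, z) \<in> scalar_equiv h"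
    from xy obtain c where c: "x \<in> quintic_solutions h" "c \<noteq> 0" "y = scale_quintuple c x"
      unfolding scalar_equiv_def mem_Collect_eq prod.case by iprover
    from yz obtain d where d: "z \<in> quintic_solutions h" "d \<noteq> 0" "z = scale_quintuple d y"
      unfolding scalar_equiv_def mem_Collect_eq prod.case by iprover
    have "d * c \<noteq> 0 \<and> z = scale_quintuple (d * c) x"
      using c d by (simp add: scale_quintuple_def split_def mult.assoc)
    with c d show "(x, z) \<in> scalar_equiv h"
      unfolding scalar_equiv_def mem_Collect_eq prod.case by iprover
  qed
qed

end

theory Submission imports Defs "HOL-Number_Theory.Cong"
begin

text \<open>
  Let \<open>\<theta>\<close> be a root of the cubic for which the binary cubic is, up to a constant, the norm of
  \<open>x\<^sub>1 + x\<^sub>2 \<theta>\<close>. The ternary cubic is then, up to a constant, the norm of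
  \<open>z = x\<^sub>4 + x\<^sub>5 \<theta> + x\<^sub>6 \<theta>\<^sup>2\<close>, and the equation reads \<open>8 N(x) Q(x) = 13 N(z) Q'(z)\<close> with \<open>Q\<close>, \<open>Q'\<close>
  the two quadratic forms. For every \<open>h\<close> it has the solution \<open>(6, -7, 12, -14, 0)\<close>.
  New solutions come from old ones in two ways.

  (1) The pair of binary forms \<open>(N, Q)\<close> has an automorphism of order three (the cubic is cyclic), which
  may be applied to \<open>x\<close> while \<open>z\<close> stays fixed (\<open>solution_rot\<close>).

  (2) Fix the ratio \<open>z / x\<close> in the cubic algebra. Along \<open>z = y X\<close> with \<open>y\<close> fixed, both norms are
  proportional to \<open>N(X)\<close>, so the equation becomes a quadratic in \<open>X = (X\<^sub>1 : X\<^sub>2)\<close>; one root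
  is \<open>x\<close>, hence the other root is rational too (\<open>solution_other_root\<close>).

  Alternating (1) and (2) yields a sequence of solutions that are polynomials in \<open>h\<close>. To see that they are
  pairwise inequivalent, specialise to \<open>h = -3\<close>. There the cubic splits with roots \<open>0, 1, 2\<close>,
  the form \<open>Q'\<close> is the square of \<open>z \<mapsto> z(1)\<close>, and step (2) just reverses the triple of values
  \<open>x(0), x(1), x(2)\<close>. So \<open>(x\<^sub>1 : x\<^sub>2)\<close> returns to \<open>(6 : -7)\<close> after every second round, whereas
  \<open>x\<^sub>4 / x\<^sub>1\<close> is multiplied by \<open>-9/4\<close> (\<open>point_even_0\<close>).

  Finally put \<open>h = 9 m - 3\<close>, which makes all coefficients integral. The \<open>k\<close>-th solution for
  \<open>m\<close> is congruent modulo \<open>m\<close> to the one for \<open>m = 0\<close> (\<open>cong_point\<close>), so any finite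
  number of nonvanishing conditions that hold at \<open>m = 0\<close> hold for all large \<open>m\<close>
  (\<open>eventually_nonzero\<close>). The conditions used are \<open>x\<^sub>1 \<noteq> 0\<close>, \<open>x\<^sub>4 \<noteq> 0\<close> and, for each pair
  of solutions, the nonvanishing of the minor formed by \<open>x\<^sub>1\<close> and \<open>x\<^sub>4\<close>.
\<close>

section \<open>The cubic algebra and its norm\<close>

text \<open>The triple \<open>(a, b, c)\<close> stands for \<open>a + b \<theta> + c \<theta>\<^sup>2\<close>, where
  \<open>\<theta>\<^sup>3 = (3 - 9 m) \<theta>\<^sup>2 + (18 m - 2) \<theta> - 8 m\<close>.\<close>
type_synonym triple = "int \<times> int \<times> int"

fun times_theta :: "int \<Rightarrow> triple \<Rightarrow> triple" where
  "times_theta m (a, b, c) = (- 8 * m * c, a + (18 * m - 2) * c, b + (3 - 9 * m) * c)"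

fun plus3 :: "triple \<Rightarrow> triple \<Rightarrow> triple" where
  "plus3 (a, b, c) (a', b', c') = (a + a', b + b', c + c')"

fun scale3 :: "int \<Rightarrow> triple \<Rightarrow> triple" where
  "scale3 k (a, b, c) = (k * a, k * b, k * c)"

definition mult_linear :: "int \<Rightarrow> triple \<Rightarrow> int \<Rightarrow> int \<Rightarrow> triple" where
  "mult_linear m z x y = plus3 (scale3 x z) (scale3 y (times_theta m z))"

fun norm3 :: "int \<Rightarrow> triple \<Rightarrow> int" where
  "norm3 m (a, b, c) =
     a^3 + (3 - 9 * m) * a^2 * b + (81 * m^2 - 18 * m + 5) * a^2 * c
     + (2 - 18 * m) * a * b^2 + (162 * m^2 - 48 * m + 6) * a * b * c
     + (180 * m^2 - 24 * m + 4) * a * c^2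
     - 8 * m * b^3 + 24 * m * (3 * m - 1) * b^2 * c + 16 * m * (9 * m - 1) * b * c^2 + 64 * m^2 * c^3"

definition norm2 :: "int \<Rightarrow> int \<Rightarrow> int \<Rightarrow> int" where
  "norm2 m x y = x^3 + (3 - 9 * m) * x^2 * y + (2 - 18 * m) * x * y^2 - 8 * m * y^3"

definition quad2 :: "int \<Rightarrow> int \<Rightarrow> int" where
  "quad2 x y = 3 * x^2 + 6 * x * y + 4 * y^2"

fun quad3 :: "int \<Rightarrow> triple \<Rightarrow> int" where
  "quad3 m (a, b, c) = (a + b + c)^2 + 9 * m * (49 * a^2 - 36 * b^2 + c^2)"

text \<open>The product of \<open>z\<close> with the adjugate of \<open>x + y \<theta>\<close>, that is, with the element whose product with
  \<open>x + y \<theta>\<close> is the norm of \<open>x + y \<theta>\<close>. This replaces a division by \<open>x + y \<theta>\<close>.\<close>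
definition mult_adj :: "int \<Rightarrow> triple \<Rightarrow> int \<Rightarrow> int \<Rightarrow> triple" where
  "mult_adj m z x y =
     plus3 (scale3 (x^2 + (3 - 9 * m) * x * y + (2 - 18 * m) * y^2) z)
       (plus3 (scale3 (- x * y - (3 - 9 * m) * y^2) (times_theta m z))
          (scale3 (y^2) (times_theta m (times_theta m z))))"

lemmas triple_simps = mult_linear_def mult_adj_def norm2_def quad2_def
  times_theta.simps plus3.simps scale3.simps norm3.simps quad3.simps

lemma norm3_mult_linear: "norm3 m (mult_linear m z x y) = norm3 m z * norm2 m x y"
proof -
  obtain a b c where z: "z = (a, b, c)" by (cases z)
  show ?thesis unfolding z triple_simps by algebra
qed

lemma norm3_mult_adj: "norm3 m (mult_adj m z x y) = norm3 m z * (norm2 m x y)^2"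
proof -
  obtain a b c where z: "z = (a, b, c)" by (cases z)
  show ?thesis unfolding z triple_simps by algebra
qed

lemma mult_linear_mult_adj: "mult_linear m (mult_adj m z x y) x y = scale3 (norm2 m x y) z"
proof -
  obtain a b c where z: "z = (a, b, c)" by (cases z)
  show ?thesis unfolding z triple_simps prod.inject by (intro conjI; algebra)
qed

lemma norm3_scale3: "norm3 m (scale3 k z) = k^3 * norm3 m z"
proof -
  obtain a b c where z: "z = (a, b, c)" by (cases z)
  show ?thesis unfolding z triple_simps by algebra
qed

lemma quad3_scale3: "quad3 m (scale3 k z) = k^2 * quad3 m z"
proof -
  obtain a b c where z: "z = (a, b, c)" by (cases z)
  show ?thesis unfolding z triple_simps by algebra
qed

text \<open>The substitution \<open>(x, y) \<mapsto> (- 2 x - 2 y, 3/2 x + y)\<close> has determinant \<open>1\<close> and order \<open>3\<close>, permutes the linear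
  factors of the norm cyclically up to scalars and fixes both forms. The factor \<open>2\<close> clears its denominator.\<close>
lemma norm2_rot: "norm2 m (- 4 * x - 4 * y) (3 * x + 2 * y) = 8 * norm2 m x y"
  unfolding norm2_def by algebra

lemma quad2_rot: "quad2 (- 4 * x - 4 * y) (3 * x + 2 * y) = 4 * quad2 x y"
  unfolding quad2_def by algebra

lemma quad3_mult_linear:
  obtains k where "\<And>x y. quad3 m (mult_linear m z x y) = quad3 m z * x^2 + k * x * y + quad3 m (times_theta m z) * y^2"
proof -
  obtain a b c where z: "z = (a, b, c)" by (cases z)
  obtain a' b' c' where z': "times_theta m z = (a', b', c')" by (cases "times_theta m z")
  have "quad3 m (mult_linear m z x y) = quad3 m z * x^2
      + (2 * (a + b + c) * (a' + b' + c') + 18 * m * (49 * a * a' - 36 * b * b' + c * c')) * x * y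
      + quad3 m (times_theta m z) * y^2" for x y
    unfolding mult_linear_def z' unfolding z triple_simps by algebra
  then show thesis by (rule that)
qed

section \<open>Two ways of making new solutions\<close>

text \<open>The quintic equation for \<open>h = 9 m - 3\<close>, divided by \<open>81\<close>: the binary cubic is \<open>9\<close> times,
  and the ternary cubic \<open>81\<close> times, the respective norm.\<close>
definition solution :: "int \<Rightarrow> int \<times> int \<times> triple \<Rightarrow> bool" where
  "solution m = (\<lambda>(x, y, z). 8 * norm2 m x y * quad2 x y = 13 * norm3 m z * quad3 m z)"

text \<open>With \<open>z = (w / N) (x + y \<theta>)\<close>, where \<open>N\<close> is the norm of \<open>x + y \<theta>\<close>, the condition on \<open>(X, Y)\<close> for
  \<open>(X, Y, (w / N) (X + Y \<theta>))\<close> to be a solution is a binary quadratic equation after division by the norm of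
  \<open>X + Y \<theta>\<close>. Its coefficients at \<open>X\<^sup>2\<close> and \<open>Y\<^sup>2\<close> are \<open>\<alpha>\<close> and \<open>\<gamma>\<close>. As \<open>(x : y)\<close> is one root,
  Vieta's formula for the product of the roots makes \<open>(\<gamma> y : \<alpha> x)\<close> the other. The result is scaled by \<open>N\<close>,
  so that it is a polynomial in the input.\<close>
definition other_root :: "int \<Rightarrow> int \<times> int \<times> triple \<Rightarrow> int \<times> int \<times> triple" where
  "other_root m = (\<lambda>(x, y, z).
     let N = norm2 m x y; w = mult_adj m z x y;
       \<alpha> = 24 * N^3 - 13 * norm3 m z * quad3 m w;
       \<gamma> = 32 * N^3 - 13 * norm3 m z * quad3 m (times_theta m w)
     in (N * \<gamma> * y, N * \<alpha> * x, mult_linear m w (\<gamma> * y) (\<alpha> * x)))"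

definition rot :: "int \<times> int \<times> triple \<Rightarrow> int \<times> int \<times> triple" where
  "rot = (\<lambda>(x, y, z). (- 4 * x - 4 * y, 3 * x + 2 * y, scale3 2 z))"

lemma solution_rot:
  assumes "solution m s"
  shows "solution m (rot s)"
proof -
  obtain x y z where s: "s = (x, y, z)" by (cases s)
  show ?thesis
    using assms unfolding s solution_def rot_def prod.case norm2_rot quad2_rot norm3_scale3 quad3_scale3
    by algebra
qed

text \<open>The argument uses no division, so it covers the degenerate cases \<open>N = 0\<close> and \<open>x y = 0\<close>, in
  which the result may be the zero vector.\<close>
lemma solution_other_root:
  assumes "solution m s"
  shows "solution m (other_root m s)"
proof -
  obtain x y z where s: "s = (x, y, z)" by (cases s)
  define N where "N = norm2 m x y"
  define w where "w = mult_adj m z x y"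
  define \<alpha> where "\<alpha> = 24 * N^3 - 13 * norm3 m z * quad3 m w"
  define \<gamma> where "\<gamma> = 32 * N^3 - 13 * norm3 m z * quad3 m (times_theta m w)"
  obtain k where k: "quad3 m (mult_linear m w X Y) = quad3 m w * X^2 + k * X * Y + quad3 m (times_theta m w) * Y^2"
    for X Y using quad3_mult_linear[of m w] by blast
  define \<beta> where "\<beta> = 48 * N^3 - 13 * norm3 m z * k"
  have q: "8 * N^3 * quad2 X Y - 13 * norm3 m z * quad3 m (mult_linear m w X Y) = \<alpha> * X^2 + \<beta> * X * Y + \<gamma> * Y^2" for X Y
    unfolding \<alpha>_def \<beta>_def \<gamma>_def k quad2_def by algebra
  have "8 * N * quad2 x y = 13 * norm3 m z * quad3 m z"
    using assms by (simp add: s solution_def N_def)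
  then have "8 * N^3 * quad2 x y - 13 * norm3 m z * quad3 m (mult_linear m w x y) = 0"
    unfolding w_def mult_linear_mult_adj quad3_scale3 N_def[symmetric] by algebra
  then have root: "\<alpha> * x^2 + \<beta> * x * y + \<gamma> * y^2 = 0"
    by (simp add: q)
  define X where "X = \<gamma> * y"
  define Y where "Y = \<alpha> * x"
  have "\<alpha> * X^2 + \<beta> * X * Y + \<gamma> * Y^2 = \<alpha> * \<gamma> * (\<alpha> * x^2 + \<beta> * x * y + \<gamma> * y^2)"
    unfolding X_def Y_def by algebra
  then have e: "8 * N^3 * quad2 X Y = 13 * norm3 m z * quad3 m (mult_linear m w X Y)"
    using root q[of X Y] by simp
  have 1: "norm2 m (N * X) (N * Y) = N^3 * norm2 m X Y" "quad2 (N * X) (N * Y) = N^2 * quad2 X Y"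
    unfolding norm2_def quad2_def by algebra+
  have 2: "norm3 m (mult_linear m w X Y) = norm3 m z * N^2 * norm2 m X Y"
    by (simp add: norm3_mult_linear w_def norm3_mult_adj N_def)
  have "8 * norm2 m (N * X) (N * Y) * quad2 (N * X) (N * Y)
      = 13 * norm3 m (mult_linear m w X Y) * quad3 m (mult_linear m w X Y)"
    unfolding 1 2 using e by algebra
  moreover have "other_root m s = (N * X, N * Y, mult_linear m w X Y)"
    by (simp add: s other_root_def Let_def N_def w_def X_def Y_def \<alpha>_def \<gamma>_def mult.assoc)
  ultimately show ?thesis by (simp add: solution_def)
qed

text \<open>At the initial solution \<open>49 x\<^sub>4\<^sup>2 = 36 x\<^sub>5\<^sup>2\<close> and \<open>x\<^sub>6 = 0\<close>, so the parameter drops out of the ternary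
  quadratic form.\<close>
definition point :: "int \<Rightarrow> nat \<Rightarrow> int \<times> int \<times> triple" where
  "point m k = ((\<lambda>s. other_root m (rot s)) ^^ k) (6, -7, 12, -14, 0)"

lemma point_0: "point m 0 = (6, -7, 12, -14, 0)"
  by (simp add: point_def)

lemma point_Suc: "point m (Suc k) = other_root m (rot (point m k))"
  by (simp add: point_def)

lemma solution_point: "solution m (point m k)"
proof (induction k)
  case 0
  show ?case by (simp add: point_0 solution_def norm2_def quad2_def)
next
  case (Suc k)
  then show ?case by (simp add: point_Suc solution_rot solution_other_root)
qed

section \<open>The sequence at \<open>m = 0\<close>\<close>

text \<open>For \<open>m = 0\<close> the algebra is the product of the evaluations at \<open>\<theta> = 0, 1, 2\<close>, and \<open>Q'(z)\<close>
  is the square of the value at \<open>1\<close>. Hence the quadratic equation says that \<open>Q(X, Y) / (X + Y)\<^sup>2\<close> is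
  constant. In the values \<open>a, b, c\<close> of \<open>X + Y \<theta>\<close> at \<open>0, 1, 2\<close>, which satisfy \<open>a + c = 2 b\<close>, the quotient is \<open>t\<^sup>2 - 2 t + 4\<close> with \<open>t = a / b\<close>.
  The other root has \<open>2 - t\<close> in place of \<open>t\<close>, which amounts to exchanging \<open>a\<close> and \<open>c\<close>.\<close>
lemma other_root_0:
  assumes "solution 0 (x, y, z1, z2, z3)"
    and root: "other_root 0 (x, y, z1, z2, z3) = (x', y', z1', z2', z3')"
  defines "K \<equiv> 8 * x^3 * (x + 2 * y)^2 * (norm2 0 x y)^2 * y"
  shows "x' = K * (x + 2 * y)" and "y' = - K * y" and "x * z1' = z1 * x'"
proof -
  define N where "N = norm2 0 x y"
  have N: "N = x * (x + y) * (x + 2 * y)"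
    unfolding N_def norm2_def by algebra
  define z where "z = (z1, z2, z3)"
  define w where "w = mult_adj 0 z x y"
  define c where "c = 13 * norm3 0 z * quad3 0 z"
  have c: "c = 8 * N * quad2 x y"
    using assms(1) by (simp add: solution_def c_def z_def N_def)
  \<comment> \<open>Evaluation at \<open>1\<close> does not distinguish \<open>w\<close> from \<open>\<theta> w\<close>, so both coefficients contain the same square,
     and the equation satisfied by \<open>(x, y, z)\<close> eliminates \<open>z\<close> from it.\<close>
  have "13 * norm3 0 z * quad3 0 w = c * (x * (x + 2 * y))^2"
    "13 * norm3 0 z * quad3 0 (times_theta 0 w) = c * (x * (x + 2 * y))^2"
    unfolding c_def w_def z_def triple_simps by algebra+
  then have \<alpha>: "24 * N^3 - 13 * norm3 0 z * quad3 0 w = - 8 * x^2 * (x + 2 * y)^2 * N * y^2"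
    and \<gamma>: "32 * N^3 - 13 * norm3 0 z * quad3 0 (times_theta 0 w) = 8 * x^3 * (x + 2 * y)^3 * N"
    unfolding c N quad2_def by algebra+
  let ?\<gamma> = "8 * x^3 * (x + 2 * y)^3 * N" and ?\<alpha> = "- 8 * x^2 * (x + 2 * y)^2 * N * y^2"
  have 1: "x' = N * ?\<gamma> * y" "y' = N * ?\<alpha> * x"
    and 2: "(z1', z2', z3') = mult_linear 0 w (?\<gamma> * y) (?\<alpha> * x)"
    using root unfolding other_root_def Let_def prod.case N_def[symmetric] z_def[symmetric] w_def[symmetric] \<alpha> \<gamma>
      prod.inject by simp_all
  have "z1' = z1 * (x + y) * (x + 2 * y) * ?\<gamma> * y"
    using 2 unfolding w_def z_def triple_simps prod.inject by algebra
  then show "x * z1' = z1 * x'" unfolding 1 N by algebra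
  show "x' = K * (x + 2 * y)" "y' = - K * y"
    unfolding 1 K_def N_def[symmetric] by algebra+
qed

text \<open>One round, in terms of the values \<open>a, b, c\<close> of \<open>x + y \<theta>\<close> at \<open>0, 1, 2\<close>: up to a factor, the rotation
  followed by the reversal maps them to \<open>a, - c / 2, - 2 b\<close>, and \<open>z\<^sub>1 / x\<close> is multiplied by \<open>- a / (2 b)\<close>.\<close>
lemma other_root_rot_0:
  assumes sol: "solution 0 (x, y, z1, z2, z3)"
    and step: "other_root 0 (rot (x, y, z1, z2, z3)) = (x', y', z1', z2', z3')"
    and nz: "x \<noteq> 0" "x + y \<noteq> 0" "x + 2 * y \<noteq> 0" "3 * x + 2 * y \<noteq> 0"
  shows "x' \<noteq> 0" and "2 * x * y' = - (3 * x + 2 * y) * x'" and "- 2 * (x + y) * z1' = z1 * x'"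
proof -
  define X where "X = - 4 * x - 4 * y"
  define Y where "Y = 3 * x + 2 * y"
  have XY: "X + 2 * Y = 2 * x" "X + Y = - (x + 2 * y)" by (simp_all add: X_def Y_def)
  have rot: "rot (x, y, z1, z2, z3) = (X, Y, 2 * z1, 2 * z2, 2 * z3)"
    by (simp add: rot_def X_def Y_def)
  define K where "K = 8 * X^3 * (X + 2 * Y)^2 * (norm2 0 X Y)^2 * Y"
  note r = other_root_0[OF solution_rot[OF sol, unfolded rot] step[unfolded rot], folded K_def]
  have "norm2 0 X Y = X * (X + Y) * (X + 2 * Y)"
    unfolding norm2_def by algebra
  moreover have "X \<noteq> 0" "Y \<noteq> 0" using nz by (simp_all add: X_def Y_def)
  ultimately have "K \<noteq> 0" using nz unfolding K_def XY by simp
  then show "x' \<noteq> 0" using nz by (simp add: r(1) XY)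
  show "2 * x * y' = - (3 * x + 2 * y) * x'"
    unfolding r(1,2) XY unfolding Y_def by algebra
  have "X * z1' = 2 * z1 * x'" using r(3) by (simp only: mult.assoc)
  then have "2 * (- 2 * (x + y) * z1') = 2 * (z1 * x')" unfolding X_def by algebra
  then show "- 2 * (x + y) * z1' = z1 * x'" by (simp only: mult_cancel_left) simp
qed

text \<open>The slope \<open>y / x\<close> alternates between \<open>- 7/6\<close> and \<open>- 1/3\<close>, and \<open>z\<^sub>1 / x\<close> is multiplied by \<open>3\<close> and
  by \<open>- 3/4\<close> in turn.\<close>
lemma point_even_0:
  assumes "point 0 (2 * k) = (x, y, z1, z2, z3)"
  shows "x \<noteq> 0 \<and> 6 * y = - 7 * x \<and> 4^k * z1 = 2 * (- 9)^k * x"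
  using assms
proof (induction k arbitrary: x y z1 z2 z3)
  case 0
  then show ?case by (simp add: point_0)
next
  case (Suc k)
  obtain x0 y0 a0 b0 c0 where p0: "point 0 (2 * k) = (x0, y0, a0, b0, c0)"
    by (metis prod_cases5)
  obtain x1 y1 a1 b1 c1 where p1: "point 0 (Suc (2 * k)) = (x1, y1, a1, b1, c1)"
    by (metis prod_cases5)
  have IH: "x0 \<noteq> 0" "6 * y0 = - 7 * x0" "4^k * a0 = 2 * (- 9)^k * x0"
    using Suc.IH[OF p0] by auto
  have nz0: "x0 + y0 \<noteq> 0" "x0 + 2 * y0 \<noteq> 0" "3 * x0 + 2 * y0 \<noteq> 0"
    using IH by linarith+
  note step0 = other_root_rot_0[OF solution_point[of 0 "2 * k", unfolded p0]
      p1[unfolded point_Suc p0] IH(1) nz0]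
  have "x0 * (3 * y1 + x1) = 0" using step0(2) IH(2) by algebra
  then have y1: "3 * y1 = - x1" using IH(1) by simp
  have nz1: "x1 + y1 \<noteq> 0" "x1 + 2 * y1 \<noteq> 0" "3 * x1 + 2 * y1 \<noteq> 0"
    using step0(1) y1 by linarith+
  have p2: "point 0 (Suc (Suc (2 * k))) = (x, y, z1, z2, z3)"
    using Suc.prems by simp
  note step1 = other_root_rot_0[OF solution_point[of 0 "Suc (2 * k)", unfolded p1]
      p2[unfolded point_Suc[of 0 "Suc (2 * k)"] p1] step0(1) nz1]
  have "x1 * (6 * y + 7 * x) = 0" using step1(2) y1 by algebra
  then have y: "6 * y = - 7 * x" using step0(1) by simp
  have a1: "x0 * a1 = 3 * a0 * x1" using step0(3) IH(2) by algebra
  have z1: "4 * x1 * z1 = - 3 * a1 * x" using step1(3) y1 by algebra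
  define e g where "e = (4::int)^k" and "g = (- 9::int)^k"
  have "e * a0 = 2 * g * x0" using IH(3) by (simp only: e_def g_def)
  with a1 z1 have "(x0 * x1) * (4 * e * z1) = (x0 * x1) * (2 * (- 9 * g) * x)"
    by algebra
  moreover have "x0 * x1 \<noteq> 0" using IH(1) step0(1) by simp
  ultimately have "4 * e * z1 = 2 * (- 9 * g) * x"
    using mult_left_cancel by blast
  then have "4^Suc k * z1 = 2 * (- 9)^Suc k * x"
    unfolding power_Suc e_def g_def .
  with step1(1) y show ?case by (intro conjI)
qed

section \<open>Comparing \<open>m\<close> with \<open>0\<close> modulo \<open>m\<close>\<close>

fun cong3 :: "int \<Rightarrow> triple \<Rightarrow> triple \<Rightarrow> bool" where
  "cong3 m (a, b, c) (a', b', c') \<longleftrightarrow> [a = a'] (mod m) \<and> [b = b'] (mod m) \<and> [c = c'] (mod m)"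

lemma cong_zero_self: "[m = 0] (mod m)" for m :: int
  by (simp add: cong_def)

lemmas cong_rules = cong_add cong_mult cong_diff cong_pow cong_refl cong_zero_self

lemma cong3_plus3: "cong3 m z z' \<Longrightarrow> cong3 m w w' \<Longrightarrow> cong3 m (plus3 z w) (plus3 z' w')"
  by (cases z; cases z'; cases w; cases w') (auto intro: cong_add)

lemma cong3_scale3: "[k = k'] (mod m) \<Longrightarrow> cong3 m z z' \<Longrightarrow> cong3 m (scale3 k z) (scale3 k' z')"
  by (cases z; cases z') (auto intro: cong_mult)

lemma cong3_times_theta: "cong3 m z z' \<Longrightarrow> cong3 m (times_theta m z) (times_theta 0 z')"
  by (cases z; cases z'; hypsubst; unfold times_theta.simps cong3.simps; elim conjE; intro conjI cong_rules; assumption)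

lemma cong3_mult_linear:
  "cong3 m z z' \<Longrightarrow> [x = x'] (mod m) \<Longrightarrow> [y = y'] (mod m) \<Longrightarrow>
   cong3 m (mult_linear m z x y) (mult_linear 0 z' x' y')"
  unfolding mult_linear_def by (intro cong3_plus3 cong3_scale3 cong3_times_theta)

lemma cong_uminus: "[a = b] (mod m) \<Longrightarrow> [- a = - b] (mod m)" for m :: int
  by (simp add: cong_minus_minus_iff)

lemma cong3_mult_adj:
  "cong3 m z z' \<Longrightarrow> [x = x'] (mod m) \<Longrightarrow> [y = y'] (mod m) \<Longrightarrow>
   cong3 m (mult_adj m z x y) (mult_adj 0 z' x' y')"
  unfolding mult_adj_def by (intro cong3_plus3 cong3_scale3 cong3_times_theta cong_rules cong_uminus)

lemma cong_norm2:
  "[x = x'] (mod m) \<Longrightarrow> [y = y'] (mod m) \<Longrightarrow> [norm2 m x y = norm2 0 x' y'] (mod m)"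
  unfolding norm2_def by (intro cong_rules)

lemma cong_norm3: "cong3 m z z' \<Longrightarrow> [norm3 m z = norm3 0 z'] (mod m)"
  by (cases z; cases z'; hypsubst; unfold norm3.simps cong3.simps; elim conjE; intro conjI cong_rules; assumption)

lemma cong_quad3: "cong3 m z z' \<Longrightarrow> [quad3 m z = quad3 0 z'] (mod m)"
  by (cases z; cases z'; hypsubst; unfold quad3.simps cong3.simps; elim conjE; intro conjI cong_rules; assumption)

definition cong_state :: "int \<Rightarrow> int \<times> int \<times> triple \<Rightarrow> int \<times> int \<times> triple \<Rightarrow> bool" where
  "cong_state m = (\<lambda>(x, y, z) (x', y', z'). [x = x'] (mod m) \<and> [y = y'] (mod m) \<and> cong3 m z z')"

lemma cong_rot: "cong_state m s s' \<Longrightarrow> cong_state m (rot s) (rot s')"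
  by (cases s; cases s'; hypsubst; unfold cong_state_def rot_def prod.case; elim conjE;
      intro conjI cong3_scale3 cong_rules cong_uminus; assumption)

lemma cong_other_root: "cong_state m s s' \<Longrightarrow> cong_state m (other_root m s) (other_root 0 s')"
  by (cases s; cases s'; hypsubst; unfold cong_state_def other_root_def prod.case Let_def; elim conjE;
      intro conjI cong3_mult_linear cong3_mult_adj cong3_times_theta cong_rules cong_norm2 cong_norm3 cong_quad3; assumption)

lemma cong_point: "cong_state m (point m k) (point 0 k)"
proof (induction k)
  case 0
  show ?case by (simp add: cong_state_def point_0)
next
  case (Suc k)
  then show ?case by (simp add: point_Suc cong_rot cong_other_root)
qed

text \<open>A nonzero integer has no divisor exceeding its absolute value.\<close>
lemma eventually_nonzero:
  fixes f :: "int \<Rightarrow> int"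
  assumes "\<And>m. [f m = f 0] (mod m)" and "f 0 \<noteq> 0"
  shows "\<forall>\<^sub>F m in at_top. f m \<noteq> 0"
  using eventually_gt_at_top[of "\<bar>f 0\<bar>"]
proof eventually_elim
  case (elim m)
  show "f m \<noteq> 0"
  proof
    assume "f m = 0"
    with assms(1)[of m] have "m dvd f 0"
      by (metis cong_0_iff cong_sym)
    then have "\<bar>m\<bar> \<le> \<bar>f 0\<bar>" using assms(2) by (intro dvd_imp_le_int)
    then show False using elim by linarith
  qed
qed

section \<open>Inequivalence of the solutions\<close>

definition coord1 :: "int \<times> int \<times> triple \<Rightarrow> int" where
  "coord1 = (\<lambda>(x, y, z). x)"

definition coord4 :: "int \<times> int \<times> triple \<Rightarrow> int" where
  "coord4 = (\<lambda>(x, y, a, b, c). a)"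

lemma cong_coord1: "[coord1 (point m k) = coord1 (point 0 k)] (mod m)"
  using cong_point[of m k] by (auto simp: cong_state_def coord1_def split: prod.splits)

lemma cong_coord4: "[coord4 (point m k) = coord4 (point 0 k)] (mod m)"
  using cong_point[of m k] by (auto simp: cong_state_def coord4_def split: prod.splits)

lemma coord_ratio_0:
  "coord1 (point 0 (2 * k)) \<noteq> 0 \<and>
   rat_of_int (coord4 (point 0 (2 * k))) = 2 * (- 9 / 4)^k * rat_of_int (coord1 (point 0 (2 * k)))"
proof -
  obtain x y a b c where p: "point 0 (2 * k) = (x, y, a, b, c)"
    by (metis prod_cases5)
  have "rat_of_int (4^k * a) = rat_of_int (2 * (- 9)^k * x)"
    using point_even_0[OF p] by metis
  then have "rat_of_int a = 2 * (- 9 / 4)^k * rat_of_int x"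
    unfolding power_divide by (simp add: field_simps)
  then show ?thesis using point_even_0[OF p] by (simp add: p coord1_def coord4_def)
qed

lemma minor_0_nonzero:
  assumes "i \<noteq> j"
  shows "coord4 (point 0 (2 * i)) * coord1 (point 0 (2 * j)) \<noteq> coord4 (point 0 (2 * j)) * coord1 (point 0 (2 * i))"
proof
  assume "coord4 (point 0 (2 * i)) * coord1 (point 0 (2 * j)) = coord4 (point 0 (2 * j)) * coord1 (point 0 (2 * i))"
  then have "rat_of_int (coord4 (point 0 (2 * i))) * rat_of_int (coord1 (point 0 (2 * j)))
    = rat_of_int (coord4 (point 0 (2 * j))) * rat_of_int (coord1 (point 0 (2 * i)))"
    by (metis of_int_mult)
  then have "(- 9 / 4 :: rat)^i = (- 9 / 4)^j"
    using coord_ratio_0[of i] coord_ratio_0[of j] by simp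
  then have "\<bar>(- 9 / 4 :: rat)^i\<bar> = \<bar>(- 9 / 4)^j\<bar>" by simp
  then have "(9 / 4 :: rat)^i = (9 / 4)^j" unfolding power_abs by simp
  then show False using assms power_inject_exp[of "9 / 4 :: rat" i j] by simp
qed

section \<open>Passage to rational quintuples\<close>

definition quintuple_of :: "int \<times> int \<times> triple \<Rightarrow> quintuple" where
  "quintuple_of = (\<lambda>(x, y, a, b, c). (of_int x, of_int y, of_int a, of_int b, of_int c))"

lemma binary_cubic_eq_norm2:
  "binary_cubic (of_int (9 * m - 3)) (of_int x) (of_int y) = 9 * of_int (norm2 m x y)"
  unfolding binary_cubic_def norm2_def by (simp add: algebra_simps)

lemma ternary_cubic_eq_norm3:
  "ternary_cubic (of_int (9 * m - 3)) (of_int a) (of_int b) (of_int c) = 81 * of_int (norm3 m (a, b, c))"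
proof -
  define M A B C where "M = rat_of_int m" and "A = rat_of_int a" and "B = rat_of_int b" and "C = rat_of_int c"
  show ?thesis
    unfolding ternary_cubic_def norm3.simps of_int_add of_int_diff of_int_mult of_int_power of_int_numeral of_int_1
      M_def[symmetric] A_def[symmetric] B_def[symmetric] C_def[symmetric] by algebra
qed

lemma quintuple_of_solution:
  assumes "solution m s" "coord1 s \<noteq> 0" "coord4 s \<noteq> 0"
  shows "quintuple_of s \<in> quintic_solutions (9 * m - 3)"
proof -
  obtain x y a b c where s: "s = (x, y, a, b, c)" by (metis prod_cases5)
  have "rat_of_int (8 * norm2 m x y * quad2 x y) = rat_of_int (13 * norm3 m (a, b, c) * quad3 m (a, b, c))"
    using assms(1) by (simp only: s solution_def prod.case)
  moreover have "binary_quadratic (of_int x) (of_int y) = of_int (quad2 x y)"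
    by (simp add: binary_quadratic_def quad2_def)
  moreover have "ternary_quadratic (of_int (9 * m - 3)) (of_int a) (of_int b) (of_int c) = of_int (quad3 m (a, b, c))"
    by (simp add: ternary_quadratic_def)
  ultimately have "quintic_lhs (of_int (9 * m - 3)) (of_int x) (of_int y)
      = quintic_rhs (of_int (9 * m - 3)) (of_int a) (of_int b) (of_int c)"
    unfolding quintic_lhs_def quintic_rhs_def binary_cubic_eq_norm2 ternary_cubic_eq_norm3 of_int_mult of_int_numeral
    by algebra
  then show ?thesis
    using assms(2,3) unfolding quintic_solutions_def
    by (simp add: s quintuple_of_def coord1_def coord4_def)
qed

lemma scalar_equiv_minor:
  assumes "(quintuple_of s, quintuple_of t) \<in> scalar_equiv h"
  shows "coord4 s * coord1 t = coord4 t * coord1 s"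
proof -
  obtain x y a b c where s: "s = (x, y, a, b, c)" by (metis prod_cases5)
  obtain x' y' a' b' c' where t: "t = (x', y', a', b', c')" by (metis prod_cases5)
  obtain k where "quintuple_of t = scale_quintuple k (quintuple_of s)"
    using assms unfolding scalar_equiv_def mem_Collect_eq prod.case by iprover
  then have "rat_of_int x' = k * of_int x" "rat_of_int a' = k * of_int a"
    by (simp_all add: s t quintuple_of_def scale_quintuple_def)
  then have "rat_of_int (a * x') = rat_of_int (a' * x)" by simp
  then show ?thesis by (simp only: of_int_eq_iff s t coord1_def coord4_def prod.case)
qed

theorem mainTheorem10:
  fixes n :: nat
  assumes "n \<ge> 1"
  shows "infinite {h :: int. \<exists>T \<subseteq> quintic_solutions h // scalar_equiv h.
           finite T \<and> card T = n \<and> (\<forall>C \<in> T. \<exists>x \<in> C. integer_quintuple x)}"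
proof -
  let ?H = "{h :: int. \<exists>T \<subseteq> quintic_solutions h // scalar_equiv h.
           finite T \<and> card T = n \<and> (\<forall>C \<in> T. \<exists>x \<in> C. integer_quintuple x)}"
  define P where "P m k = point m (2 * k)" for m k
  have 1: "\<forall>\<^sub>F m in at_top. coord1 (P m i) \<noteq> 0" for i
    unfolding P_def by (intro eventually_nonzero cong_coord1 conjunct1[OF coord_ratio_0])
  have 2: "\<forall>\<^sub>F m in at_top. coord4 (P m i) \<noteq> 0" for i
    unfolding P_def by (intro eventually_nonzero cong_coord4) (use coord_ratio_0[of i] in auto)
  have 3: "\<forall>\<^sub>F m in at_top. i \<noteq> j \<longrightarrow> coord4 (P m i) * coord1 (P m j) - coord4 (P m j) * coord1 (P m i) \<noteq> 0"
    for i j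
  proof (cases "i = j")
    case False
    have "\<forall>\<^sub>F m in at_top. coord4 (P m i) * coord1 (P m j) - coord4 (P m j) * coord1 (P m i) \<noteq> 0"
      unfolding P_def using minor_0_nonzero[OF False]
      by (intro eventually_nonzero cong_diff cong_mult cong_coord1 cong_coord4) simp
    then show ?thesis by (rule eventually_mono) simp
  qed simp
  have "\<forall>\<^sub>F m in at_top. \<forall>i\<in>{..<n}. coord1 (P m i) \<noteq> 0 \<and> coord4 (P m i) \<noteq> 0 \<and>
      (\<forall>j\<in>{..<n}. i \<noteq> j \<longrightarrow> coord4 (P m i) * coord1 (P m j) - coord4 (P m j) * coord1 (P m i) \<noteq> 0)"
    by (intro eventually_ball_finite eventually_conj finite_lessThan ballI 1 2 3)
  then have "\<forall>\<^sub>F m in at_top. 9 * m - 3 \<in> ?H"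
  proof eventually_elim
    case (elim m)
    let ?h = "9 * m - 3"
    define v where "v i = quintuple_of (P m i)" for i
    define T where "T = (\<lambda>i. scalar_equiv ?h `` {v i}) ` {..<n}"
    have v: "v i \<in> quintic_solutions ?h" if "i < n" for i
      unfolding v_def using elim that by (intro quintuple_of_solution) (auto simp: P_def solution_point)
    have "inj_on (\<lambda>i. scalar_equiv ?h `` {v i}) {..<n}"
    proof (rule inj_onI)
      fix i j
      assume ij: "i \<in> {..<n}" "j \<in> {..<n}" and "scalar_equiv ?h `` {v i} = scalar_equiv ?h `` {v j}"
      then have "(v i, v j) \<in> scalar_equiv ?h"
        using v eq_equiv_class[OF _ equiv_scalar_equiv] by blast
      then have "coord4 (P m i) * coord1 (P m j) = coord4 (P m j) * coord1 (P m i)"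
        unfolding v_def by (rule scalar_equiv_minor)
      moreover have "i \<noteq> j \<longrightarrow> coord4 (P m i) * coord1 (P m j) - coord4 (P m j) * coord1 (P m i) \<noteq> 0"
        using elim ij by blast
      ultimately show "i = j" by auto
    qed
    then have "card T = n" unfolding T_def by (simp add: card_image)
    moreover have "T \<subseteq> quintic_solutions ?h // scalar_equiv ?h"
      unfolding T_def using v by (auto intro: quotientI)
    moreover have "\<exists>x \<in> C. integer_quintuple x" if "C \<in> T" for C
    proof -
      obtain i where "i < n" "C = scalar_equiv ?h `` {v i}" using \<open>C \<in> T\<close> by (auto simp: T_def)
      then have "v i \<in> C" using v equiv_class_self[OF equiv_scalar_equiv] by blast
      moreover have "integer_quintuple (v i)"
        by (simp add: v_def quintuple_of_def integer_quintuple_def split_def)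
      ultimately show ?thesis by blast
    qed
    moreover have "finite T" by (simp add: T_def)
    ultimately show ?case by (intro CollectI exI[of _ T] conjI ballI)
  qed
  then obtain M where "9 * m - 3 \<in> ?H" if "M \<le> m" for m
    unfolding eventually_at_top_linorder by blast
  then have "(\<lambda>m. 9 * m - 3) ` {M..} \<subseteq> ?H" by (intro image_subsetI) simp
  moreover have "infinite ((\<lambda>m. 9 * m - 3) ` {M..})"
    by (subst finite_image_iff) (auto intro: inj_onI simp: infinite_Ici)
  ultimately show ?thesis by (rule infinite_super)
qed

end
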